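(* The group $S=\bigcup_{i=1}^{8}A_i$ has order $|S|=2\cdot 6^8$. Moreover, if $O$ is the group of all $9!$ relabelings (permutations) of the digits $1,\dots,9$, then every element of $O$ commutes with every element of $S$, $S\cdot O=O\cdot S$, and $|S\cdot O|=2\cdot 6^8\cdot 9!$.
   Context: The cells of the Sudoku grid are indexed by $(i,j)$ with $1\le i,j\le 9$ ($i$ the row index, $j$ the column index). Let $E$ be the identity transformation of the cells and $d$ the transposition $(i,j)\mapsto(j,i)$. Let $R$ be the set of row transformations $(i,j)\mapsto(\rho(i),j)$, where $\rho$ ranges over the $6^4$ permutations of $\{1,\dots,9\}$ that map each of the triplets $\{1,2,3\},\{4,5,6\},\{7,8,9\}$ onto one of these triplets. Let $R^*=R\setminus\{E\}$. Products are compositions of transformations, written so that the leftmost factor is applied first. Define $A_1=\{E\}$, $A_2=\{d\}$, $A_3=R^*$, $A_4=\{rd: r\in R^*\}$, $A_5=\{dr: r\in R^*\}$, $A_6=\{drd: r\in R^*\}$, $A_7=\{r\,d\,r': r,r'\in R^*\}$, $A_8=\{r\,d\,r'\,d: r,r'\in R^*\}$. Elements of $S$ and of $O$ are both regarded as transformations of filled $9\times 9$ grids with entries in $\{1,\dots,9\}$: an element of $S$ moves the entry in each cell to the image of that cell, and an element of $O$ (isomorphic to the symmetric group on $9$ symbols) applies a fixed permutation of $\{1,\dots,9\}$ to all entries. $S\cdot O=\{so: s\in S, o\in O\}$. *)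

theory Defs
  imports "HOL-Combinatorics.Permutations" "HOL-Algebra.Bij" "HOL-Algebra.Coset"
begin

(* The group of all bijections of X (extensional functions, arbitrary value "undefined" outside X).
   Unlike BijGroup of HOL-Algebra, a product applies its LEFT factor first. *)
definition trans_group :: "'a set \<Rightarrow> ('a \<Rightarrow> 'a) monoid" where
  "trans_group X =
    \<lparr>carrier = Bij X, mult = (\<lambda>f g. compose X g f), one = (\<lambda>x\<in>X. x)\<rparr>"

lemma group_trans_group: "group (trans_group X)"
proof (rule groupI)
  fix f assume f: "f \<in> carrier (trans_group X)"
  then have "(\<lambda>x\<in>X. inv_into X f x) \<in> Bij X"
    by (simp add: trans_group_def restrict_inv_into_Bij)
  moreover have "compose X f (\<lambda>x\<in>X. inv_into X f x) = (\<lambda>x\<in>X. x)"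
    using f by (auto simp: trans_group_def Bij_def bij_betw_def intro: compose_id_inv_into)
  ultimately show "\<exists>g\<in>carrier (trans_group X).
      g \<otimes>\<^bsub>trans_group X\<^esub> f = \<one>\<^bsub>trans_group X\<^esub>"
    by (auto simp: trans_group_def)
qed (auto simp: trans_group_def compose_Bij id_Bij Bij_imp_funcset Bij_imp_extensional
      compose_assoc[OF Bij_imp_funcset] intro!: compose_Id)

definition digits :: "nat set" where
  "digits = {1..9}"

definition cells :: "(nat \<times> nat) set" where
  "cells = digits \<times> digits"

abbreviation CellTrans :: "(nat \<times> nat \<Rightarrow> nat \<times> nat) monoid" where
  "CellTrans \<equiv> trans_group cells"

definition triplets :: "nat set set" where
  "triplets = {{1,2,3}, {4,5,6}, {7,8,9}}"

definition d :: "nat \<times> nat \<Rightarrow> nat \<times> nat" where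
  "d = (\<lambda>(i, j)\<in>cells. (j, i))"

definition row_trans :: "(nat \<Rightarrow> nat) \<Rightarrow> nat \<times> nat \<Rightarrow> nat \<times> nat" where
  "row_trans \<rho> = (\<lambda>(i, j)\<in>cells. (\<rho> i, j))"

definition R_set :: "(nat \<times> nat \<Rightarrow> nat \<times> nat) set" where
  "R_set = {row_trans \<rho> | \<rho>. \<rho> permutes digits \<and> (\<forall>T\<in>triplets. \<rho> ` T \<in> triplets)}"

definition R_star :: "(nat \<times> nat \<Rightarrow> nat \<times> nat) set" where
  "R_star = R_set - {\<one>\<^bsub>CellTrans\<^esub>}"

definition A1 where "A1 = {\<one>\<^bsub>CellTrans\<^esub>}"
definition A2 where "A2 = {d}"
definition A3 where "A3 = R_star"
definition A4 where "A4 = {r \<otimes>\<^bsub>CellTrans\<^esub> d | r. r \<in> R_star}"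
definition A5 where "A5 = {d \<otimes>\<^bsub>CellTrans\<^esub> r | r. r \<in> R_star}"
definition A6 where
  "A6 = {d \<otimes>\<^bsub>CellTrans\<^esub> r \<otimes>\<^bsub>CellTrans\<^esub> d | r. r \<in> R_star}"
definition A7 where
  "A7 = {r \<otimes>\<^bsub>CellTrans\<^esub> d \<otimes>\<^bsub>CellTrans\<^esub> r' | r r'. r \<in> R_star \<and> r' \<in> R_star}"
definition A8 where
  "A8 = {r \<otimes>\<^bsub>CellTrans\<^esub> d \<otimes>\<^bsub>CellTrans\<^esub> r' \<otimes>\<^bsub>CellTrans\<^esub> d | r r'.
          r \<in> R_star \<and> r' \<in> R_star}"

definition S_set :: "(nat \<times> nat \<Rightarrow> nat \<times> nat) set" where
  "S_set = A1 \<union> A2 \<union> A3 \<union> A4 \<union> A5 \<union> A6 \<union> A7 \<union> A8"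

type_synonym grid = "nat \<times> nat \<Rightarrow> nat"

(* All fillings of the cells by digits, with no Sudoku validity condition. *)
definition grids :: "grid set" where
  "grids = cells \<rightarrow>\<^sub>E digits"

abbreviation GridTrans :: "(grid \<Rightarrow> grid) monoid" where
  "GridTrans \<equiv> trans_group grids"

(* The entry of cell c is moved to cell s c, so the new entry at c is the old one at the
   preimage of c. *)
definition move_entries :: "(nat \<times> nat \<Rightarrow> nat \<times> nat) \<Rightarrow> grid \<Rightarrow> grid" where
  "move_entries s = (\<lambda>g\<in>grids. \<lambda>c\<in>cells. g (inv_into cells s c))"

definition relabel :: "(nat \<Rightarrow> nat) \<Rightarrow> grid \<Rightarrow> grid" where
  "relabel \<pi> = (\<lambda>g\<in>grids. \<lambda>c\<in>cells. \<pi> (g c))"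

definition S_grid :: "(grid \<Rightarrow> grid) set" where
  "S_grid = move_entries ` S_set"

definition O_grid :: "(grid \<Rightarrow> grid) set" where
  "O_grid = {relabel \<pi> | \<pi>. \<pi> permutes digits}"

end

theory Submission
  imports Defs
begin

text \<open>
  A row transformation followed by \<open>d\<close>, another row transformation and \<open>d\<close> again acts by
  \<open>(i, j) \<mapsto> (\<rho> i, \<sigma> j)\<close>; without the last \<open>d\<close> it acts by \<open>(i, j) \<mapsto> (\<sigma> j, \<rho> i)\<close>.
  Letting \<open>\<rho>\<close> and \<open>\<sigma>\<close> also be the identity, the eight sets \<open>A1\<close> to \<open>A8\<close> are exactly the
  special cases of these two normal forms (\<open>S_set_eq_products\<close>, \<open>S_set_eq\<close>). So \<open>S_set\<close> is
  parametrised by a bit (transpose or not) and a pair of triplet-respecting permutations of the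
  digits. The composition rule for normal forms (\<open>compose_cell_trans\<close>) shows that it is a group,
  and uniqueness of the parameters (\<open>cell_trans_inject\<close>) gives its order, twice the square of
  the number of triplet-respecting permutations.

  That number is \<open>6 ^ 4\<close>: such a permutation is a permutation of the three triplets together
  with one permutation of the three positions for each triplet, an element of the wreath product
  of two copies of the symmetric group on three letters (\<open>card_triplet_perms\<close>).

  On grids, moving the entries composes with the inverse of a cell transformation on the right and
  relabelling composes with \<open>\<pi>\<close> on the left, so the two operations commute. A product of both
  determines its factors (\<open>move_relabel_inject\<close>): on constant grids only the relabelling is
  visible, and once it is known, a grid with a single distinguished cell reveals where the moved
  entries came from. Hence the orders multiply.
\<close>

section \<open>Permutations that respect the triplets\<close>

definition triplet_perms :: "(nat \<Rightarrow> nat) set" where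
  "triplet_perms = {\<rho>. \<rho> permutes digits \<and> (\<forall>T\<in>triplets. \<rho> ` T \<in> triplets)}"

lemma triplet_perms_permutes: "\<rho> \<in> triplet_perms \<Longrightarrow> \<rho> permutes digits"
  by (simp add: triplet_perms_def)

lemma triplet_perms_id: "id \<in> triplet_perms"
  by (simp add: triplet_perms_def permutes_id)

lemma triplet_perms_comp:
  assumes "\<rho> \<in> triplet_perms" "\<sigma> \<in> triplet_perms"
  shows "\<rho> \<circ> \<sigma> \<in> triplet_perms"
  using assms by (auto simp: triplet_perms_def image_comp[symmetric] permutes_compose simp del: o_apply image_comp)

text \<open>
  A permutation that maps triplets to triplets does so injectively, hence bijectively because
  there are finitely many; every triplet is thus the image of a triplet, and the inverse
  permutation takes it back.
\<close>

lemma triplet_perms_inv: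
  assumes "\<rho> \<in> triplet_perms"
  shows "inv_into UNIV \<rho> \<in> triplet_perms"
proof -
  have perm: "\<rho> permutes digits" and trip: "\<And>T. T \<in> triplets \<Longrightarrow> \<rho> ` T \<in> triplets"
    using assms by (auto simp: triplet_perms_def)
  have "inj \<rho>" using perm by (rule permutes_inj)
  then have "inj_on ((`) \<rho>) triplets"
    by (auto simp: inj_on_def inj_image_eq_iff)
  then have "(`) \<rho> ` triplets = triplets"
    using trip by (intro endo_inj_surj) (simp add: triplets_def, blast)
  then have "inv_into UNIV \<rho> ` T \<in> triplets" if "T \<in> triplets" for T
    using that \<open>inj \<rho>\<close> by (metis (no_types, lifting) image_iff image_inv_f_f)
  then show ?thesis
    using perm by (simp add: triplet_perms_def permutes_inv)
qed

text \<open>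
  A digit is \<open>3 * a + b + 1\<close> with \<open>a, b < 3\<close>: \<open>a\<close> numbers its triplet and \<open>b\<close> its
  place there, both from zero.
\<close>

definition block :: "nat \<Rightarrow> nat" where
  "block i = (i - 1) div 3"

definition pos :: "nat \<Rightarrow> nat" where
  "pos i = (i - 1) mod 3"

lemma block_pos [simp]:
  assumes "b < 3"
  shows "block (3 * a + b + 1) = a" "pos (3 * a + b + 1) = b"
  using assms by (simp_all add: block_def pos_def)

lemma digit_of_block_pos: "i \<in> digits \<Longrightarrow> 3 * block i + pos i + 1 = i"
  by (simp add: digits_def block_def pos_def)

lemma block_less: "i \<in> digits \<Longrightarrow> block i < 3"
  by (auto simp: digits_def block_def)

lemma pos_less: "pos i < 3"
  by (simp add: pos_def)

lemma digit_of_coords: "a < 3 \<Longrightarrow> b < 3 \<Longrightarrow> 3 * a + b + 1 \<in> digits"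
  by (auto simp: digits_def)

lemma digits_eq_iff:
  "i \<in> digits \<Longrightarrow> j \<in> digits \<Longrightarrow> i = j \<longleftrightarrow> block i = block j \<and> pos i = pos j"
  by (metis digit_of_block_pos)

lemma triplets_eq_blocks: "triplets = (\<lambda>a. {i \<in> digits. block i = a}) ` {..<3}"
proof -
  have "i \<in> digits \<and> block i = 0 \<longleftrightarrow> i \<in> {1,2,3}"
    "i \<in> digits \<and> block i = 1 \<longleftrightarrow> i \<in> {4,5,6}"
    "i \<in> digits \<and> block i = 2 \<longleftrightarrow> i \<in> {7,8,9}" for i
    unfolding digits_def block_def by (simp_all, presburger+)
  then have "{i \<in> digits. block i = 0} = {1,2,3}" "{i \<in> digits. block i = 1} = {4,5,6}"
    "{i \<in> digits. block i = 2} = {7,8,9}"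
    by (simp_all only: set_eq_iff mem_Collect_eq simp_thms)
  moreover have "{..<3} = {0,1,2::nat}" by auto
  ultimately show ?thesis by (simp add: triplets_def)
qed

text \<open>
  Keeping digits of one triplet together suffices: the image of a triplet then lies in some
  triplet, and since both have three elements the inclusion is an equality. This form needs no
  reasoning about images of sets when permutations are built from coordinates.
\<close>

lemma triplet_perms_iff_block:
  "\<rho> \<in> triplet_perms \<longleftrightarrow> \<rho> permutes digits \<and>
    (\<forall>i\<in>digits. \<forall>j\<in>digits. block i = block j \<longrightarrow> block (\<rho> i) = block (\<rho> j))"
proof (intro iffI conjI ballI impI)
  assume "\<rho> \<in> triplet_perms"
  then show "\<rho> permutes digits" by (rule triplet_perms_permutes)
next
  fix i j assume *: "\<rho> \<in> triplet_perms" "i \<in> digits" "j \<in> digits" "block i = block j"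
  then have "\<rho> ` {k \<in> digits. block k = block i} \<in> triplets"
    unfolding triplet_perms_def triplets_eq_blocks using block_less by blast
  then obtain a where a: "\<rho> ` {k \<in> digits. block k = block i} = {k \<in> digits. block k = a}"
    by (auto simp: triplets_eq_blocks)
  have "\<rho> i \<in> {k \<in> digits. block k = a}" "\<rho> j \<in> {k \<in> digits. block k = a}"
    unfolding a[symmetric] using * by auto
  then show "block (\<rho> i) = block (\<rho> j)" by simp
next
  assume *: "\<rho> permutes digits \<and>
    (\<forall>i\<in>digits. \<forall>j\<in>digits. block i = block j \<longrightarrow> block (\<rho> i) = block (\<rho> j))"
  have "\<rho> ` T \<in> triplets" if T: "T \<in> triplets" for T
  proof -
    obtain a where a: "a < 3" "T = {i \<in> digits. block i = a}"
      using T by (auto simp: triplets_eq_blocks)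
    define T' where "T' = {i \<in> digits. block i = block (\<rho> (3 * a + 0 + 1))}"
    have dig: "3 * a + 0 + 1 \<in> digits" using a by (intro digit_of_coords) auto
    have bl: "block (3 * a + 0 + 1) = a" by (intro block_pos) simp
    have \<rho>dig: "\<rho> i \<in> digits" if "i \<in> digits" for i
      using * that by (simp add: permutes_in_image)
    have sub: "\<rho> ` T \<subseteq> T'"
    proof
      fix k assume "k \<in> \<rho> ` T"
      then obtain i where i: "i \<in> digits" "block i = a" "k = \<rho> i" using a by auto
      then have "block (\<rho> i) = block (\<rho> (3 * a + 0 + 1))"
        using * dig bl by metis
      then show "k \<in> T'" using i \<rho>dig by (simp add: T'_def)
    qed
    have T': "T' \<in> triplets"
      using block_less[OF \<rho>dig[OF dig]] by (auto simp: triplets_eq_blocks T'_def)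
    have card3: "card U = 3" if "U \<in> triplets" for U
      using that by (auto simp: triplets_def)
    have "card (\<rho> ` T) = card T'"
      using * card3[OF T] card3[OF T'] by (subst card_image) (auto simp: permutes_inj_on)
    moreover have "finite T'" by (simp add: T'_def digits_def)
    ultimately show ?thesis using sub T' card_subset_eq by metis
  qed
  then show "\<rho> \<in> triplet_perms" using * by (simp add: triplet_perms_def)
qed

text \<open>
  An element \<open>(\<tau>, \<alpha>)\<close> of the wreath product: \<open>\<tau>\<close> permutes the triplets and \<open>\<alpha> a\<close> the
  places inside triplet \<open>a\<close> before it is moved.
\<close>

definition wreath :: "(nat \<Rightarrow> nat) \<times> (nat \<Rightarrow> nat \<Rightarrow> nat) \<Rightarrow> nat \<Rightarrow> nat" where
  "wreath = (\<lambda>(\<tau>, \<alpha>) i. if i \<in> digits then 3 * \<tau> (block i) + \<alpha> (block i) (pos i) + 1 else i)"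

abbreviation wreath_coords :: "((nat \<Rightarrow> nat) \<times> (nat \<Rightarrow> nat \<Rightarrow> nat)) set" where
  "wreath_coords \<equiv>
    {\<tau>. \<tau> permutes {..<3}} \<times> ({..<3} \<rightarrow>\<^sub>E {\<alpha>. \<alpha> permutes {..<3}})"

lemma wreath_coords_less:
  assumes "(\<tau>, \<alpha>) \<in> wreath_coords" "i \<in> digits"
  shows "\<tau> (block i) < 3" "\<alpha> (block i) (pos i) < 3" "\<alpha> (block i) permutes {..<3}"
proof -
  show *: "\<alpha> (block i) permutes {..<3}" using assms block_less by (auto simp: PiE_def Pi_def)
  show "\<alpha> (block i) (pos i) < 3" using permutes_in_image[OF *, of "pos i"] pos_less by simp
  have "\<tau> permutes {..<3}" using assms by simp
  then show "\<tau> (block i) < 3"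
    using permutes_in_image[of \<tau> "{..<3}" "block i"] block_less[OF assms(2)] by simp
qed

lemma
  assumes "(\<tau>, \<alpha>) \<in> wreath_coords" "i \<in> digits"
  shows wreath_in_digits: "wreath (\<tau>, \<alpha>) i \<in> digits"
    and block_wreath: "block (wreath (\<tau>, \<alpha>) i) = \<tau> (block i)"
    and pos_wreath: "pos (wreath (\<tau>, \<alpha>) i) = \<alpha> (block i) (pos i)"
proof -
  have w: "wreath (\<tau>, \<alpha>) i = 3 * \<tau> (block i) + \<alpha> (block i) (pos i) + 1"
    using assms(2) by (simp add: wreath_def)
  show "wreath (\<tau>, \<alpha>) i \<in> digits" unfolding w
    by (intro digit_of_coords wreath_coords_less[OF assms])
  show "block (wreath (\<tau>, \<alpha>) i) = \<tau> (block i)" "pos (wreath (\<tau>, \<alpha>) i) = \<alpha> (block i) (pos i)"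
    unfolding w by (intro block_pos wreath_coords_less[OF assms])+
qed

lemma wreath_triplet_perms:
  assumes "(\<tau>, \<alpha>) \<in> wreath_coords"
  shows "wreath (\<tau>, \<alpha>) \<in> triplet_perms"
proof -
  have inj: "inj_on (wreath (\<tau>, \<alpha>)) digits"
  proof (rule inj_onI)
    fix i j assume ij: "i \<in> digits" "j \<in> digits" "wreath (\<tau>, \<alpha>) i = wreath (\<tau>, \<alpha>) j"
    have "\<tau> (block i) = \<tau> (block j)"
      using ij assms by (metis block_wreath)
    moreover have "inj \<tau>" using assms by (auto intro: permutes_inj)
    ultimately have bl: "block i = block j" by (simp add: inj_eq)
    have "\<alpha> (block i) (pos i) = \<alpha> (block i) (pos j)"
      using ij assms bl by (metis pos_wreath)
    moreover have "inj (\<alpha> (block i))"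
      using wreath_coords_less(3)[OF assms ij(1)] by (rule permutes_inj)
    ultimately have "pos i = pos j" by (simp add: inj_eq)
    with bl show "i = j" using ij digits_eq_iff by blast
  qed
  have "wreath (\<tau>, \<alpha>) ` digits = digits"
    using inj wreath_in_digits[OF assms] by (intro endo_inj_surj) (auto simp: digits_def)
  then have "wreath (\<tau>, \<alpha>) permutes digits"
    using inj by (intro bij_imp_permutes) (auto simp: bij_betw_def wreath_def)
  then show ?thesis
    using block_wreath[OF assms] by (simp add: triplet_perms_iff_block)
qed

lemma wreath_inj: "inj_on wreath wreath_coords"
proof (rule inj_onI)
  fix x y assume x: "x \<in> wreath_coords" and y: "y \<in> wreath_coords" and eq: "wreath x = wreath y"
  obtain \<tau> \<alpha> \<tau>' \<alpha>' where xy: "x = (\<tau>, \<alpha>)" "y = (\<tau>', \<alpha>')" by fastforce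
  note x' = x[unfolded xy] and y' = y[unfolded xy]
  have coord: "\<tau> a = \<tau>' a \<and> \<alpha> a b = \<alpha>' a b" if "a < 3" "b < 3" for a b
    using block_wreath[OF x' digit_of_coords[OF that]] block_wreath[OF y' digit_of_coords[OF that]]
      pos_wreath[OF x' digit_of_coords[OF that]] pos_wreath[OF y' digit_of_coords[OF that]]
      eq that by (simp add: xy del: One_nat_def add_Suc_right)
  have "\<tau> = \<tau>'"
  proof
    fix a show "\<tau> a = \<tau>' a"
      using coord[of a 0] x' y' by (cases "a < 3") (auto simp: permutes_def)
  qed
  moreover have "\<alpha> = \<alpha>'"
  proof (rule PiE_ext)
    show "\<alpha> \<in> {..<3} \<rightarrow>\<^sub>E {\<alpha>. \<alpha> permutes {..<3}}" "\<alpha>' \<in> {..<3} \<rightarrow>\<^sub>E {\<alpha>. \<alpha> permutes {..<3}}"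
      using x' y' by auto
    fix a :: nat assume a: "a \<in> {..<3}"
    then have "\<alpha> a permutes {..<3}" "\<alpha>' a permutes {..<3}"
      using x' y' by (auto simp: PiE_def Pi_def)
    then show "\<alpha> a = \<alpha>' a"
      using coord[of a] a by (intro ext) (metis lessThan_iff permutes_not_in)
  qed
  ultimately show "x = y" by (simp add: xy)
qed

text \<open>
  The coordinates of \<open>\<rho>\<close> are read off from it: \<open>\<tau>\<close> from the first digit of every triplet,
  which may stand for all of them because \<open>\<rho>\<close> keeps triplets together, and \<open>\<alpha> a\<close> from the
  positions of the images of the digits in triplet \<open>a\<close>.
\<close>

lemma wreath_surj:
  assumes \<rho>: "\<rho> \<in> triplet_perms"
  shows "\<rho> \<in> wreath ` wreath_coords"
proof -
  have perm: "\<rho> permutes digits" by (rule triplet_perms_permutes[OF \<rho>])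
  have dig: "\<rho> i \<in> digits" if "i \<in> digits" for i
    using perm that by (simp add: permutes_in_image)
  have same: "block i = block j \<Longrightarrow> block (\<rho> i) = block (\<rho> j)" if "i \<in> digits" "j \<in> digits" for i j
    using \<rho> that unfolding triplet_perms_iff_block by blast
  have \<rho>inj: "\<rho> i = \<rho> j \<longleftrightarrow> i = j" for i j
    using permutes_inj[OF perm] by (simp add: inj_eq)
  \<comment> \<open>Outside its range each coordinate is forced: a permutation of \<open>{..<3}\<close> fixes all other
    numbers, and \<open>\<alpha>\<close> is extensional.\<close>
  define \<tau> where "\<tau> = (\<lambda>a. if a < 3 then block (\<rho> (3 * a + 0 + 1)) else a)"
  define \<alpha> where
    "\<alpha> = (\<lambda>a\<in>{..<3}. \<lambda>b. if b < 3 then pos (\<rho> (3 * a + b + 1)) else b)"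
  have \<tau>: "\<tau> (block i) = block (\<rho> i)" if "i \<in> digits" for i
  proof -
    have "block (3 * block i + 0 + 1) = block i" by (intro block_pos) simp
    moreover have "3 * block i + 0 + 1 \<in> digits"
      using that by (intro digit_of_coords block_less) auto
    ultimately show ?thesis
      using same[of "3 * block i + 0 + 1" i] block_less[OF that] that by (simp add: \<tau>_def)
  qed
  have \<alpha>: "\<alpha> (block i) (pos i) = pos (\<rho> i)" if "i \<in> digits" for i
    using that by (simp add: \<alpha>_def block_less pos_less digit_of_block_pos
        del: One_nat_def add_Suc_right)
  have "\<tau> permutes {..<3}"
  proof (rule bij_imp_permutes)
    have "{..<3} \<subseteq> \<tau> ` {..<3}"
    proof
      fix a :: nat assume "a \<in> {..<3}"
      then have a: "3 * a + 0 + 1 \<in> digits" by (intro digit_of_coords) auto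
      moreover have "\<rho> ` digits = digits" using perm by (rule permutes_image)
      ultimately obtain i where i: "i \<in> digits" "\<rho> i = 3 * a + 0 + 1" by (metis imageE)
      have "\<tau> (block i) = a" unfolding \<tau>[OF i(1)] i(2) by (intro block_pos) simp
      then show "a \<in> \<tau> ` {..<3}" using block_less[OF i(1)] by auto
    qed
    moreover have "\<tau> ` {..<3} \<subseteq> {..<3}"
    proof -
      have "block (\<rho> (3 * a + 0 + 1)) < 3" if "a < 3" for a
        using that by (intro block_less dig digit_of_coords) auto
      then show ?thesis by (auto simp: \<tau>_def)
    qed
    ultimately have "\<tau> ` {..<3} = {..<3}" by blast
    then show "bij_betw \<tau> {..<3} {..<3}"
      by (simp add: bij_betw_def eq_card_imp_inj_on)
  qed (simp add: \<tau>_def)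
  moreover have "\<alpha> a permutes {..<3}" if a: "a < 3" for a
  proof (rule bij_imp_permutes)
    have inj: "inj_on (\<alpha> a) {..<3}"
    proof (rule inj_onI)
      fix b b' :: nat assume b: "b \<in> {..<3}" "b' \<in> {..<3}" "\<alpha> a b = \<alpha> a b'"
      let ?i = "3 * a + b + 1" and ?j = "3 * a + b' + 1"
      have ij: "?i \<in> digits" "?j \<in> digits" using a b by (auto intro!: digit_of_coords simp del: One_nat_def add_Suc_right)
      have "pos (\<rho> ?i) = pos (\<rho> ?j)" using a b by (simp add: \<alpha>_def)
      moreover have "block (\<rho> ?i) = block (\<rho> ?j)"
        using same[OF ij] b by (simp del: One_nat_def add_Suc_right)
      ultimately have "\<rho> ?i = \<rho> ?j" using digits_eq_iff[OF dig dig] ij by blast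
      then show "b = b'" by (simp add: \<rho>inj)
    qed
    have "\<alpha> a ` {..<3} \<subseteq> {..<3}" using a by (auto simp: \<alpha>_def pos_less)
    then have "\<alpha> a ` {..<3} = {..<3}" using inj by (intro endo_inj_surj) auto
    then show "bij_betw (\<alpha> a) {..<3} {..<3}" using inj by (simp add: bij_betw_def)
  qed (use a in \<open>simp add: \<alpha>_def\<close>)
  then have "\<alpha> \<in> {..<3} \<rightarrow>\<^sub>E {\<alpha>. \<alpha> permutes {..<3}}"
    by (intro PiE_I) (simp_all add: \<alpha>_def)
  moreover have "\<rho> = wreath (\<tau>, \<alpha>)"
  proof
    fix i show "\<rho> i = wreath (\<tau>, \<alpha>) i"
      using digit_of_block_pos[OF dig, of i] perm
      by (cases "i \<in> digits") (simp_all add: wreath_def \<tau> \<alpha> permutes_not_in)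
  qed
  ultimately show ?thesis by blast
qed

lemma card_triplet_perms: "card triplet_perms = 6 ^ 4"
proof -
  have "wreath ` wreath_coords = triplet_perms"
    using wreath_triplet_perms wreath_surj by auto
  then have "card triplet_perms = card wreath_coords"
    using card_image[OF wreath_inj] by simp
  moreover have "card {\<tau>. \<tau> permutes {..<3::nat}} = 6"
    by (subst card_permutations[of _ 3]) (auto simp: fact_numeral)
  ultimately show ?thesis
    by (simp add: card_cartesian_product card_PiE)
qed


section \<open>The group of cell transformations\<close>

text \<open>
  The normal form of an element of \<open>S_set\<close>. In both cases \<open>\<rho>\<close> acts on the old row index and
  \<open>\<sigma>\<close> on the old column index; if \<open>t\<close> holds, the two results are exchanged afterwards.
\<close>

definition cell_trans :: "bool \<Rightarrow> (nat \<Rightarrow> nat) \<Rightarrow> (nat \<Rightarrow> nat) \<Rightarrow> nat \<times> nat \<Rightarrow> nat \<times> nat" where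
  "cell_trans t \<rho> \<sigma> =
    (\<lambda>(i, j)\<in>cells. if t then (\<sigma> j, \<rho> i) else (\<rho> i, \<sigma> j))"

lemma cell_trans_in_cells:
  assumes "\<rho> permutes digits" "\<sigma> permutes digits" "c \<in> cells"
  shows "cell_trans t \<rho> \<sigma> c \<in> cells"
  using assms by (auto simp: cell_trans_def cells_def permutes_in_image)

text \<open>
  After a transposing \<open>cell_trans\<close> the old column index sits in the row position, so the
  permutations of the second factor meet those of the first one crosswise.
\<close>

lemma compose_cell_trans:
  assumes "\<rho> permutes digits" "\<sigma> permutes digits"
  shows "compose cells (cell_trans t' \<rho>' \<sigma>') (cell_trans t \<rho> \<sigma>) =
    (if t then cell_trans (\<not> t') (\<sigma>' \<circ> \<rho>) (\<rho>' \<circ> \<sigma>)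
     else cell_trans t' (\<rho>' \<circ> \<rho>) (\<sigma>' \<circ> \<sigma>))"
  using assms
  by (auto simp: fun_eq_iff compose_def cell_trans_def cells_def permutes_in_image)

lemma cell_trans_id: "cell_trans False id id = \<one>\<^bsub>CellTrans\<^esub>"
  by (auto simp: cell_trans_def trans_group_def fun_eq_iff)

lemma cell_trans_inverse:
  assumes "\<rho> permutes digits" "\<sigma> permutes digits"
  shows "cell_trans t \<rho> \<sigma> \<otimes>\<^bsub>CellTrans\<^esub>
    (if t then cell_trans True (inv_into UNIV \<sigma>) (inv_into UNIV \<rho>)
     else cell_trans False (inv_into UNIV \<rho>) (inv_into UNIV \<sigma>))
    = \<one>\<^bsub>CellTrans\<^esub>"
  using assms
  by (simp add: cell_trans_id[symmetric])
     (simp add: trans_group_def compose_cell_trans permutes_inv_o)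

lemma cell_trans_Bij:
  assumes "\<rho> permutes digits" "\<sigma> permutes digits"
  shows "cell_trans t \<rho> \<sigma> \<in> Bij cells"
proof -
  have "inj_on (cell_trans t \<rho> \<sigma>) cells"
    by (auto simp: inj_on_def cell_trans_def permutes_inj[OF assms(1), THEN inj_eq]
        permutes_inj[OF assms(2), THEN inj_eq] split: if_splits)
  moreover from this have "cell_trans t \<rho> \<sigma> ` cells = cells"
    by (intro endo_inj_surj image_subsetI cell_trans_in_cells[OF assms])
       (simp_all add: cells_def digits_def)
  ultimately show ?thesis
    by (auto simp: Bij_def bij_betw_def cell_trans_def)
qed

lemma cell_trans_inject:
  assumes perm: "\<rho> permutes digits" "\<sigma> permutes digits" "\<rho>' permutes digits" "\<sigma>' permutes digits"
    and eq: "cell_trans t \<rho> \<sigma> = cell_trans t' \<rho>' \<sigma>'"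
  shows "t = t' \<and> \<rho> = \<rho>' \<and> \<sigma> = \<sigma>'"
proof -
  have at: "cell_trans t \<rho> \<sigma> (i, j) = cell_trans t' \<rho>' \<sigma>' (i, j)" for i j
    by (simp add: eq)
  have dig: "1 \<in> digits" "2 \<in> digits" by (auto simp: digits_def)
  have ne: "\<rho> 1 \<noteq> \<rho> 2" "\<rho>' 1 \<noteq> \<rho>' 2"
    by (simp_all add: perm(1,3)[THEN permutes_inj, THEN inj_eq])
  \<comment> \<open>Without transposition the first coordinate of the image depends on the row, with
    transposition it does not; rows 1 and 2 tell the cases apart.\<close>
  have t: "t = t'"
    using at[of 1 1] at[of 2 1] dig ne
    by (cases t; cases t') (auto simp: cell_trans_def cells_def)
  have "\<rho> i = \<rho>' i \<and> \<sigma> i = \<sigma>' i" for i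
  proof (cases "i \<in> digits")
    case True
    then show ?thesis using at[of i i] t by (auto simp: cell_trans_def cells_def split: if_splits)
  next
    case False
    then show ?thesis using perm by (simp add: permutes_not_in)
  qed
  then show ?thesis using t by auto
qed

lemma d_eq: "d = cell_trans True id id"
  by (auto simp: d_def cell_trans_def fun_eq_iff)

lemma row_trans_eq: "row_trans \<rho> = cell_trans False \<rho> id"
  by (auto simp: row_trans_def cell_trans_def fun_eq_iff)

lemma R_set_eq: "R_set = (\<lambda>\<rho>. cell_trans False \<rho> id) ` triplet_perms"
  by (auto simp: R_set_def triplet_perms_def row_trans_eq)

lemma row_d_row:
  assumes "\<rho> permutes digits" "\<sigma> permutes digits"
  shows "cell_trans False \<rho> id \<otimes>\<^bsub>CellTrans\<^esub> d \<otimes>\<^bsub>CellTrans\<^esub> cell_trans False \<sigma> id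
      = cell_trans True \<rho> \<sigma>"
    and "cell_trans False \<rho> id \<otimes>\<^bsub>CellTrans\<^esub> d \<otimes>\<^bsub>CellTrans\<^esub> cell_trans False \<sigma> id
        \<otimes>\<^bsub>CellTrans\<^esub> d = cell_trans False \<rho> \<sigma>"
  using assms
  by (simp_all add: trans_group_def d_eq compose_cell_trans permutes_id)

lemma products_insert:
  assumes "f e e = a" "\<And>r. r \<in> X \<Longrightarrow> f r e = g r" "\<And>r. r \<in> X \<Longrightarrow> f e r = h r"
  shows "{f r r' | r r'. r \<in> insert e X \<and> r' \<in> insert e X} =
    {a} \<union> {g r | r. r \<in> X} \<union> {h r | r. r \<in> X} \<union> {f r r' | r r'. r \<in> X \<and> r' \<in> X}"
proof -
  have "{g r | r. r \<in> X} = {f r e | r. r \<in> X}" "{h r | r. r \<in> X} = {f e r | r. r \<in> X}"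
    using assms(2,3) by force+
  then show ?thesis using assms(1) by blast
qed

text \<open>
  Since \<open>d\<close> is an involution, inserting the identity for \<open>r\<close> or \<open>r'\<close> turns \<open>r d r'\<close> into the
  elements of \<open>A2\<close>, \<open>A4\<close> and \<open>A5\<close>, and \<open>r d r' d\<close> into those of \<open>A1\<close>, \<open>A3\<close> and \<open>A6\<close>.
  Allowing all of \<open>R_set\<close> in \<open>A7\<close> and \<open>A8\<close> therefore absorbs the other six sets.
\<close>

lemma S_set_eq_products:
  "S_set = {r \<otimes>\<^bsub>CellTrans\<^esub> d \<otimes>\<^bsub>CellTrans\<^esub> r' | r r'. r \<in> R_set \<and> r' \<in> R_set}
    \<union> {r \<otimes>\<^bsub>CellTrans\<^esub> d \<otimes>\<^bsub>CellTrans\<^esub> r' \<otimes>\<^bsub>CellTrans\<^esub> d | r r'. r \<in> R_set \<and> r' \<in> R_set}"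
  (is "_ = ?odd \<union> ?even")
proof -
  interpret group CellTrans by (rule group_trans_group)
  have dC: "d \<in> carrier CellTrans"
    by (simp add: d_eq trans_group_def cell_trans_Bij permutes_id)
  have RC: "R_set \<subseteq> carrier CellTrans"
    by (auto simp: R_set_eq trans_group_def triplet_perms_permutes permutes_id
        intro!: cell_trans_Bij)
  have dd: "d \<otimes>\<^bsub>CellTrans\<^esub> d = \<one>\<^bsub>CellTrans\<^esub>"
    using cell_trans_inverse[of id id True] by (simp add: d_eq permutes_id)
  have rdd: "r \<otimes>\<^bsub>CellTrans\<^esub> d \<otimes>\<^bsub>CellTrans\<^esub> d = r" if "r \<in> R_set" for r
    using subsetD[OF RC that] dC by (simp add: m_assoc dd)
  have R: "R_set = insert \<one>\<^bsub>CellTrans\<^esub> R_star"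
    using triplet_perms_id by (auto simp: R_star_def R_set_eq cell_trans_id[symmetric])
  have star: "r \<in> R_star \<Longrightarrow> r \<in> carrier CellTrans \<and> r \<in> R_set" for r
    using R RC by blast
  have odd: "?odd = A2 \<union> A4 \<union> A5 \<union> A7"
    unfolding R A2_def A4_def A5_def A7_def
    by (rule products_insert) (simp_all add: dC star)
  have even: "?even = A1 \<union> A3 \<union> A6 \<union> A8"
    unfolding R A1_def A3_def A6_def A8_def
    by (subst products_insert[where a = "\<one>\<^bsub>CellTrans\<^esub>" and g = "\<lambda>r. r"
          and h = "\<lambda>r. d \<otimes>\<^bsub>CellTrans\<^esub> r \<otimes>\<^bsub>CellTrans\<^esub> d"])
       (simp_all add: dC star dd rdd)
  show ?thesis unfolding S_set_def odd even by (simp only: Un_ac)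
qed

lemma products_image:
  assumes "\<And>\<rho> \<sigma>. \<rho> \<in> P \<Longrightarrow> \<sigma> \<in> P \<Longrightarrow> F (f \<rho>) (f \<sigma>) = G \<rho> \<sigma>"
  shows "{F r r' | r r'. r \<in> f ` P \<and> r' \<in> f ` P} = {G \<rho> \<sigma> | \<rho> \<sigma>. \<rho> \<in> P \<and> \<sigma> \<in> P}"
proof -
  have "{F r r' | r r'. r \<in> f ` P \<and> r' \<in> f ` P} = {F (f \<rho>) (f \<sigma>) | \<rho> \<sigma>. \<rho> \<in> P \<and> \<sigma> \<in> P}"
    by blast
  also have "\<dots> = {G \<rho> \<sigma> | \<rho> \<sigma>. \<rho> \<in> P \<and> \<sigma> \<in> P}"
    using assms by (intro Collect_cong) metis
  finally show ?thesis .
qed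

lemma S_set_eq:
  "S_set = (\<lambda>(t, \<rho>, \<sigma>). cell_trans t \<rho> \<sigma>) ` (UNIV \<times> triplet_perms \<times> triplet_perms)"
proof -
  have "S_set = {cell_trans True \<rho> \<sigma> | \<rho> \<sigma>. \<rho> \<in> triplet_perms \<and> \<sigma> \<in> triplet_perms}
    \<union> {cell_trans False \<rho> \<sigma> | \<rho> \<sigma>. \<rho> \<in> triplet_perms \<and> \<sigma> \<in> triplet_perms}"
    unfolding S_set_eq_products R_set_eq
    by (intro arg_cong2[where f = "(\<union>)"] products_image row_d_row triplet_perms_permutes)
  also have "\<dots> = (\<lambda>(t, \<rho>, \<sigma>). cell_trans t \<rho> \<sigma>) ` (UNIV \<times> triplet_perms \<times> triplet_perms)"
    by (simp add: set_eq_iff image_iff Bex_def ex_bool_eq) blast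
  finally show ?thesis .
qed

lemma card_S_set: "card S_set = 2 * 6 ^ 8"
proof -
  have "inj_on (\<lambda>(t, \<rho>, \<sigma>). cell_trans t \<rho> \<sigma>) (UNIV \<times> triplet_perms \<times> triplet_perms)"
    by (clarsimp simp: inj_on_def) (intro cell_trans_inject triplet_perms_permutes)
  then show ?thesis
    by (simp add: S_set_eq card_image card_cartesian_product card_triplet_perms)
qed

lemma S_set_Bij: "S_set \<subseteq> Bij cells"
  by (auto simp: S_set_eq triplet_perms_permutes intro!: cell_trans_Bij)

lemma cell_trans_in_S_set:
  "\<rho> \<in> triplet_perms \<Longrightarrow> \<sigma> \<in> triplet_perms \<Longrightarrow> cell_trans t \<rho> \<sigma> \<in> S_set"
  by (force simp: S_set_eq)

lemma subgroup_S_set: "subgroup S_set CellTrans"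
proof -
  interpret group CellTrans by (rule group_trans_group)
  show ?thesis
  proof (rule subgroupI)
    show "S_set \<subseteq> carrier CellTrans" using S_set_Bij by (simp add: trans_group_def)
    show "S_set \<noteq> {}" using triplet_perms_id by (auto simp: S_set_eq)
  next
    fix f assume f: "f \<in> S_set"
    then obtain t \<rho> \<sigma> where *: "f = cell_trans t \<rho> \<sigma>" "\<rho> \<in> triplet_perms" "\<sigma> \<in> triplet_perms"
      by (auto simp: S_set_eq)
    define g where
      "g = (if t then cell_trans True (inv_into UNIV \<sigma>) (inv_into UNIV \<rho>)
        else cell_trans False (inv_into UNIV \<rho>) (inv_into UNIV \<sigma>))"
    have g: "g \<in> S_set"
      using * by (simp add: g_def cell_trans_in_S_set triplet_perms_inv)
    have carrier: "f \<in> carrier CellTrans" "g \<in> carrier CellTrans"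
      using f g S_set_Bij by (auto simp: trans_group_def)
    have "f \<otimes>\<^bsub>CellTrans\<^esub> g = \<one>\<^bsub>CellTrans\<^esub>"
      unfolding g_def *(1) using * by (intro cell_trans_inverse triplet_perms_permutes)
    from inv_comm[OF this carrier] have "inv\<^bsub>CellTrans\<^esub> f = g"
      using carrier by (rule inv_equality)
    then show "inv\<^bsub>CellTrans\<^esub> f \<in> S_set" using g by simp
  next
    fix f g assume "f \<in> S_set" "g \<in> S_set"
    then obtain t \<rho> \<sigma> t' \<rho>' \<sigma>' where "f = cell_trans t \<rho> \<sigma>" "g = cell_trans t' \<rho>' \<sigma>'"
      "\<rho> \<in> triplet_perms" "\<sigma> \<in> triplet_perms" "\<rho>' \<in> triplet_perms" "\<sigma>' \<in> triplet_perms"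
      by (auto simp: S_set_eq)
    then show "f \<otimes>\<^bsub>CellTrans\<^esub> g \<in> S_set"
      by (simp add: trans_group_def compose_cell_trans triplet_perms_permutes triplet_perms_comp
          cell_trans_in_S_set)
  qed
qed


section \<open>Moving entries and relabelling digits\<close>

lemma move_entries_in_grids:
  assumes "s \<in> Bij cells" "g \<in> grids"
  shows "move_entries s g \<in> grids"
proof -
  have "inv_into cells s c \<in> cells" if "c \<in> cells" for c
    using assms(1) that by (auto simp: Bij_def bij_betw_def intro: inv_into_into)
  then show ?thesis using assms(2) by (auto simp: move_entries_def grids_def)
qed

lemma relabel_in_grids: "\<pi> permutes digits \<Longrightarrow> g \<in> grids \<Longrightarrow> relabel \<pi> g \<in> grids"
  by (auto simp: relabel_def grids_def permutes_in_image)

lemma move_relabel_apply: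
  assumes "\<pi> permutes digits" "s \<in> Bij cells" "g \<in> grids" "c \<in> cells"
  shows "(move_entries s \<otimes>\<^bsub>GridTrans\<^esub> relabel \<pi>) g c = \<pi> (g (inv_into cells s c))"
  using assms move_entries_in_grids[OF assms(2,3)]
  by (simp add: trans_group_def compose_def relabel_def) (simp add: move_entries_def)

lemma move_relabel_commute:
  assumes "\<pi> permutes digits" "s \<in> Bij cells"
  shows "relabel \<pi> \<otimes>\<^bsub>GridTrans\<^esub> move_entries s = move_entries s \<otimes>\<^bsub>GridTrans\<^esub> relabel \<pi>"
proof
  fix g
  show "(relabel \<pi> \<otimes>\<^bsub>GridTrans\<^esub> move_entries s) g = (move_entries s \<otimes>\<^bsub>GridTrans\<^esub> relabel \<pi>) g"
  proof (cases "g \<in> grids")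
    case True
    have "inv_into cells s c \<in> cells" if "c \<in> cells" for c
      using assms(2) that by (auto simp: Bij_def bij_betw_def intro: inv_into_into)
    then show ?thesis
      using True move_entries_in_grids[OF assms(2) True] relabel_in_grids[OF assms(1) True]
      by (auto simp: trans_group_def compose_def move_entries_def relabel_def fun_eq_iff)
  qed (simp add: trans_group_def compose_def)
qed

lemma const_grid: "k \<in> digits \<Longrightarrow> (\<lambda>c\<in>cells. k) \<in> grids"
  by (simp add: grids_def)

lemma one_one_cell: "(1, 1) \<in> cells"
  by (simp add: cells_def digits_def)

text \<open>
  Test grids separate the factors. A constant grid is unaffected by moving entries, so its image
  shows one value of \<open>\<pi>\<close>. After that, the grid that has 1 in the cell from which \<open>s\<close> fills
  \<open>c\<close> and 2 elsewhere shows that \<open>s'\<close> fills \<open>c\<close> from the same cell.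
\<close>

lemma move_relabel_inject:
  assumes "\<pi> permutes digits" "\<pi>' permutes digits" "s \<in> Bij cells" "s' \<in> Bij cells"
    and eq: "move_entries s \<otimes>\<^bsub>GridTrans\<^esub> relabel \<pi> = move_entries s' \<otimes>\<^bsub>GridTrans\<^esub> relabel \<pi>'"
  shows "s = s' \<and> \<pi> = \<pi>'"
proof -
  have at: "\<pi> (g (inv_into cells s c)) = \<pi>' (g (inv_into cells s' c))"
    if "g \<in> grids" "c \<in> cells" for g c
    using assms that by (metis move_relabel_apply)
  have pre: "inv_into cells s c \<in> cells" "inv_into cells s' c \<in> cells" if "c \<in> cells" for c
    using assms(3,4) that by (auto simp: Bij_def bij_betw_def intro: inv_into_into)
  have "\<pi> k = \<pi>' k" for k
  proof (cases "k \<in> digits")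
    case True
    then show ?thesis using at[OF const_grid one_one_cell] pre[OF one_one_cell] by simp
  next
    case False
    then show ?thesis using assms(1,2) by (simp add: permutes_not_in)
  qed
  then have \<pi>: "\<pi> = \<pi>'" by blast
  have inv_eq: "inv_into cells s c = inv_into cells s' c" if c: "c \<in> cells" for c
  proof -
    let ?g = "\<lambda>x\<in>cells. if x = inv_into cells s c then 1 else 2 :: nat"
    have "?g \<in> grids" by (auto simp: grids_def digits_def)
    from at[OF this c] have "?g (inv_into cells s c) = ?g (inv_into cells s' c)"
      by (simp only: \<pi> permutes_inj[OF assms(2), THEN inj_eq])
    then show ?thesis using pre[OF c] by (simp split: if_splits)
  qed
  have "s x = s' x" for x
  proof (cases "x \<in> cells")
    case True
    then have sx: "s x \<in> cells" using assms(3) by (auto simp: Bij_def bij_betw_def)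
    have "x = inv_into cells s (s x)"
      using assms(3) True by (simp add: Bij_def bij_betw_def inv_into_f_f)
    also have "\<dots> = inv_into cells s' (s x)" by (rule inv_eq[OF sx])
    finally show ?thesis
      using assms(4) sx by (metis (no_types, lifting) Bij_def IntD2 bij_betw_inv_into_right mem_Collect_eq)
  next
    case False
    then show ?thesis using assms(3,4) by (cases x) (simp add: Bij_def extensional_def)
  qed
  then show ?thesis using \<pi> by blast
qed

lemma relabel_comp:
  assumes "\<pi> permutes digits"
  shows "relabel \<pi> \<otimes>\<^bsub>GridTrans\<^esub> relabel \<pi>' = relabel (\<pi>' \<circ> \<pi>)"
  using relabel_in_grids[OF assms]
  by (auto simp: trans_group_def compose_def relabel_def fun_eq_iff)

lemma relabel_id: "relabel id = \<one>\<^bsub>GridTrans\<^esub>"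
  by (auto simp: relabel_def trans_group_def grids_def fun_eq_iff PiE_def extensional_def)

lemma relabel_left_inverse:
  "\<pi> permutes digits \<Longrightarrow> relabel (inv_into UNIV \<pi>) \<otimes>\<^bsub>GridTrans\<^esub> relabel \<pi> = \<one>\<^bsub>GridTrans\<^esub>"
  by (simp add: relabel_comp permutes_inv permutes_inv_o relabel_id)

lemma relabel_Bij:
  assumes "\<pi> permutes digits"
  shows "relabel \<pi> \<in> Bij grids"
proof -
  have inverse: "relabel (inv_into UNIV \<pi>) (relabel \<pi> g) = g" "relabel \<pi> (relabel (inv_into UNIV \<pi>) g) = g"
    if "g \<in> grids" for g
    using that relabel_in_grids[OF assms that] relabel_in_grids[OF permutes_inv[OF assms] that] assms
    by (auto simp: relabel_def fun_eq_iff permutes_inverses grids_def PiE_def extensional_def)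
  have "bij_betw (relabel \<pi>) grids grids"
    using inverse relabel_in_grids[OF assms] relabel_in_grids[OF permutes_inv[OF assms]]
    by (intro bij_betw_byWitness[where f' = "relabel (inv_into UNIV \<pi>)"]) auto
  then show ?thesis by (simp add: Bij_def relabel_def)
qed

lemma subgroup_O_grid: "subgroup O_grid GridTrans"
proof -
  interpret group GridTrans by (rule group_trans_group)
  show ?thesis
  proof (rule subgroupI)
    show "O_grid \<subseteq> carrier GridTrans" by (auto simp: O_grid_def trans_group_def relabel_Bij)
    show "O_grid \<noteq> {}" using permutes_id[of digits] unfolding O_grid_def by blast
  next
    fix f assume "f \<in> O_grid"
    then obtain \<pi> where \<pi>: "\<pi> permutes digits" "f = relabel \<pi>" by (auto simp: O_grid_def)
    have "f \<in> carrier GridTrans" "relabel (inv_into UNIV \<pi>) \<in> carrier GridTrans"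
      using \<pi> by (simp_all add: trans_group_def relabel_Bij permutes_inv)
    then have "inv\<^bsub>GridTrans\<^esub> f = relabel (inv_into UNIV \<pi>)"
      using relabel_left_inverse[OF \<pi>(1)] \<pi>(2) by (intro inv_equality) simp_all
    then show "inv\<^bsub>GridTrans\<^esub> f \<in> O_grid" using \<pi> by (auto simp: O_grid_def permutes_inv)
  next
    fix f g assume "f \<in> O_grid" "g \<in> O_grid"
    then show "f \<otimes>\<^bsub>GridTrans\<^esub> g \<in> O_grid"
      by (auto simp: O_grid_def relabel_comp intro: permutes_compose)
  qed
qed

lemma card_relabellings: "card {\<pi>. \<pi> permutes digits} = fact 9"
  by (rule card_permutations) (simp_all add: digits_def)

text \<open>
  Injectivity of \<open>relabel\<close> is the case of \<open>move_relabel_inject\<close> in which both cell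
  transformations are the identity.
\<close>

lemma card_O_grid: "card O_grid = fact 9"
proof -
  have "inj_on relabel {\<pi>. \<pi> permutes digits}"
  proof (rule inj_onI)
    fix \<pi> \<pi>' assume "\<pi> \<in> {\<pi>. \<pi> permutes digits}" "\<pi>' \<in> {\<pi>. \<pi> permutes digits}"
      and "relabel \<pi> = relabel \<pi>'"
    then show "\<pi> = \<pi>'" using move_relabel_inject[OF _ _ id_Bij id_Bij] by simp
  qed
  moreover have "O_grid = relabel ` {\<pi>. \<pi> permutes digits}" by (auto simp: O_grid_def)
  ultimately show ?thesis using card_image card_relabellings by metis
qed

lemma card_S_O: "card (S_grid <#>\<^bsub>GridTrans\<^esub> O_grid) = card S_set * fact 9"
proof -
  let ?f = "\<lambda>(s, \<pi>). move_entries s \<otimes>\<^bsub>GridTrans\<^esub> relabel \<pi>"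
  have inj: "inj_on ?f (S_set \<times> {\<pi>. \<pi> permutes digits})"
    using S_set_Bij by (clarsimp simp: inj_on_def) (blast dest: move_relabel_inject)
  have "S_grid <#>\<^bsub>GridTrans\<^esub> O_grid = ?f ` (S_set \<times> {\<pi>. \<pi> permutes digits})"
    by (auto simp: set_mult_def S_grid_def O_grid_def)
  then show ?thesis
    by (simp only: card_image[OF inj] card_cartesian_product card_relabellings)
qed

theorem mainTheorem2:
  shows "subgroup S_set CellTrans \<and> card S_set = 2 * 6 ^ 8
    \<and> subgroup O_grid GridTrans \<and> card O_grid = fact 9
    \<and> (\<forall>p\<in>O_grid. \<forall>s\<in>S_grid. p \<otimes>\<^bsub>GridTrans\<^esub> s = s \<otimes>\<^bsub>GridTrans\<^esub> p)
    \<and> S_grid <#>\<^bsub>GridTrans\<^esub> O_grid = O_grid <#>\<^bsub>GridTrans\<^esub> S_grid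
    \<and> card (S_grid <#>\<^bsub>GridTrans\<^esub> O_grid) = 2 * 6 ^ 8 * fact 9"
proof -
  have commute: "p \<otimes>\<^bsub>GridTrans\<^esub> s = s \<otimes>\<^bsub>GridTrans\<^esub> p" if "p \<in> O_grid" "s \<in> S_grid" for p s
    using that move_relabel_commute S_set_Bij by (auto simp: O_grid_def S_grid_def)
  then have swap: "S_grid <#>\<^bsub>GridTrans\<^esub> O_grid = O_grid <#>\<^bsub>GridTrans\<^esub> S_grid"
    unfolding set_mult_def by (subst SUP_commute) (intro SUP_cong refl, simp)
  have "card (S_grid <#>\<^bsub>GridTrans\<^esub> O_grid) = 2 * 6 ^ 8 * fact 9"
    by (simp only: card_S_O card_S_set)
  then show ?thesis
    using subgroup_S_set card_S_set subgroup_O_grid card_O_grid commute swap by blast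
qed

end
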